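(* Let $n\ge 1$ be an integer, and let $r$, $e$, $y^{(1)}$, $y^{(2)}$ be real-valued discrete-time signals, with $y=[y^{(1)},y^{(2)}]^{\intercal}$. At each time instant $k$ (with $k\ge n-1$) at which $V_n[e](k)\neq 0$, the following two inequalities hold (all quantities evaluated at time $k$): $$\big\|\Phi_n[e,\,y^{(1)}+e\,y^{(2)}]-\mu_n[y]\big\|_2\le \frac{\mathcal{C}_n(\mathbf{e}_n)}{V_n[e]}\Big(V_n[y^{(1)}]+V_n[y^{(2)}]\,\|\mathbf{e}_n\|_\infty\Big),$$ $$\big\|\Phi_n[e,r]\big\|_2\le \frac{\mathcal{C}_n(\mathbf{e}_n)}{\sqrt{n}\,V_n[e]}\,\|\mathbf{r}_n\|_2,$$ where $\mathcal{C}_n(\mathbf{e}_n)=\sqrt{V_n^2[e]+\mu_n^2[e]+1}$.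
   Context: Signals are functions of the discrete time $k\in\{0,1,2,\dots\}$; $e\,y^{(2)}$ is the pointwise product of signals. For a real-valued signal $x$ and a horizon $n\ge1$ (at times $k\ge n-1$): $\mathbf{x}_n(k)=[x(k),x(k-1),\dots,x(k-n+1)]^{\intercal}\in\mathbb{R}^n$; $\mu_n[x](k)=\frac1n\sum_{i=0}^{n-1}x(k-i)$, with powers $\mu_n^2[x]=(\mu_n[x])^2$; and $V_n[x](k)\ge 0$ is defined by $V_n^2[x](k)=\frac1n\sum_{i=0}^{n-1}x^2(k-i)-\mu_n^2[x](k)$. For the vector signal $y$, $\mu_n[y]=[\mu_n[y^{(1)}],\mu_n[y^{(2)}]]^{\intercal}$. Regression operator: with $\mathbf{1}_n\in\mathbb{R}^n$ the all-ones vector and $\phi_n[e](k)=\big[\mathbf{1}_n,\ \mathbf{e}_n(k)\big]\in\mathbb{R}^{n\times2}$, set $\Phi_n[e,r](k)=\phi_n[e](k)^{\dagger}\,\mathbf{r}_n(k)\in\mathbb{R}^2$, where $A^\dagger=(A^{\intercal}A)^{-1}A^{\intercal}$ (well defined when $V_n[e](k)\ne0$). *)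

theory Defs
  imports Complex_Main "Jordan_Normal_Form.Gauss_Jordan_Elimination"
begin

type_synonym signal = "nat \<Rightarrow> real"

(* The windowed quantities below are meaningful at times k with n - 1 \<le> k;
   before that the truncated subtraction k - i merely repeats x 0. *)

definition window :: "nat \<Rightarrow> signal \<Rightarrow> nat \<Rightarrow> real vec" where
  "window n x k = vec n (\<lambda>i. x (k - i))"

definition moving_mean :: "nat \<Rightarrow> signal \<Rightarrow> nat \<Rightarrow> real" where
  "moving_mean n x k = (1 / real n) * (\<Sum>i<n. x (k - i))"

definition moving_mean2 :: "nat \<Rightarrow> signal \<Rightarrow> signal \<Rightarrow> nat \<Rightarrow> real vec" where
  "moving_mean2 n y1 y2 k = vec_of_list [moving_mean n y1 k, moving_mean n y2 k]"

(* The radicand is nonnegative (Cauchy-Schwarz), so this is the nonnegative root. *)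
definition moving_dev :: "nat \<Rightarrow> signal \<Rightarrow> nat \<Rightarrow> real" where
  "moving_dev n x k =
     sqrt ((1 / real n) * (\<Sum>i<n. (x (k - i))\<^sup>2) - (moving_mean n x k)\<^sup>2)"

definition norm2_vec :: "real vec \<Rightarrow> real" where
  "norm2_vec v = sqrt (v \<bullet> v)"

(* Used for vectors of positive dimension only. *)
definition norm_inf_vec :: "real vec \<Rightarrow> real" where
  "norm_inf_vec v = Max ((\<lambda>i. \<bar>v $ i\<bar>) ` {..<dim_vec v})"

(* Left pseudoinverse of a matrix of full column rank; the Gram matrix is then
   invertible and mat_inverse returns Some of its inverse.  For other matrices the
   value is unspecified. *)
definition pinv :: "real mat \<Rightarrow> real mat" where
  "pinv A = the (mat_inverse (A\<^sup>T * A)) * A\<^sup>T"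

definition regressor :: "nat \<Rightarrow> signal \<Rightarrow> nat \<Rightarrow> real mat" where
  "regressor n e k = mat_of_cols n [vec n (\<lambda>_. 1), window n e k]"

definition regression :: "nat \<Rightarrow> signal \<Rightarrow> signal \<Rightarrow> nat \<Rightarrow> real vec" where
  "regression n e r k = pinv (regressor n e k) *\<^sub>v window n r k"

(* Depends on e and k only through window n e k. *)
definition cond_const :: "nat \<Rightarrow> signal \<Rightarrow> nat \<Rightarrow> real" where
  "cond_const n e k = sqrt ((moving_dev n e k)\<^sup>2 + (moving_mean n e k)\<^sup>2 + 1)"

end

theory Submission
  imports Defs "HOL-Analysis.L2_Norm" "Jordan_Normal_Form.Determinant"
begin

text \<open>Write \<open>A = [1, e]\<close> for the regressor and \<open>x = \<Phi>[e,r]\<close>. The normal equations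
  \<open>A\<^sup>T A x = A\<^sup>T r\<close> and Cauchy-Schwarz give \<open>\<parallel>A x\<parallel> \<le> \<parallel>r\<parallel>\<close>, while
  \<open>\<parallel>A (a, b)\<parallel>\<^sup>2 = n ((a + b \<mu>)\<^sup>2 + b\<^sup>2 V\<^sup>2)\<close> bounds \<open>\<parallel>x\<parallel>\<close> by \<open>C / (\<surd>n V) \<parallel>A x\<parallel>\<close>: this is the
  second inequality. For the first one, the pseudoinverse is a left inverse of \<open>A\<close>, so the error
  \<open>\<Phi>[e, y1 + e y2] - \<mu>[y]\<close> is \<open>\<Phi>[e, s]\<close> with \<open>s = (y1 - \<mu>[y1]) + e (y2 - \<mu>[y2])\<close>, and
  \<open>\<parallel>s\<parallel> \<le> \<surd>n (V[y1] + V[y2] \<parallel>e\<parallel>\<^sub>\<infinity>)\<close>.\<close>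

section \<open>Euclidean norm and adjointness\<close>

lemma norm2_vec_eq_L2_set: "norm2_vec v = L2_set (($) v) {..<dim_vec v}"
  by (simp add: norm2_vec_def L2_set_def scalar_prod_def power2_eq_square lessThan_atLeast0)

lemma norm2_vec_nonneg: "0 \<le> norm2_vec v"
  by (simp add: norm2_vec_eq_L2_set)

lemma norm2_vec_power2: "(norm2_vec v)\<^sup>2 = v \<bullet> v"
  by (simp add: norm2_vec_def scalar_prod_def sum_nonneg)

lemma norm2_vec_eq_0_iff: "v \<in> carrier_vec n \<Longrightarrow> norm2_vec v = 0 \<longleftrightarrow> v = 0\<^sub>v n"
  by (auto simp: norm2_vec_eq_L2_set L2_set_eq_0_iff)

lemma scalar_prod_le_norm2_vec:
  assumes "dim_vec v = dim_vec w"
  shows "v \<bullet> w \<le> norm2_vec v * norm2_vec w"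
proof -
  have "v \<bullet> w \<le> (\<Sum>i<dim_vec w. \<bar>v $ i\<bar> * \<bar>w $ i\<bar>)"
    unfolding scalar_prod_def lessThan_atLeast0
    by (intro sum_mono) (metis abs_ge_self abs_mult)
  also have "\<dots> \<le> norm2_vec v * norm2_vec w"
    using L2_set_mult_ineq by (simp add: norm2_vec_eq_L2_set assms)
  finally show ?thesis .
qed

lemma mult_mat_vec_scalar_prod:
  fixes A :: "real mat"
  assumes A: "A \<in> carrier_mat n m" and x: "x \<in> carrier_vec m" and y: "y \<in> carrier_vec n"
  shows "(A *\<^sub>v x) \<bullet> y = x \<bullet> (A\<^sup>T *\<^sub>v y)"
  using transpose_vec_mult_scalar[OF A x y] A x y
  by (simp add: comm_scalar_prod[of _ n] comm_scalar_prod[of _ m])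

section \<open>Pseudoinverse of a matrix of full column rank\<close>

context
  fixes A :: "real mat" and n m :: nat
  assumes A: "A \<in> carrier_mat n m"
    and inj: "\<And>x. x \<in> carrier_vec m \<Longrightarrow> A *\<^sub>v x = 0\<^sub>v n \<Longrightarrow> x = 0\<^sub>v m"
begin

text \<open>If the Gram matrix kills \<open>x\<close>, then \<open>A *\<^sub>v x\<close> has squared
  norm 0, so \<open>inj\<close> forces \<open>x\<close> to vanish. Hence the determinant is nonzero,
  and the \<open>the\<close> in \<open>pinv\<close> meets a \<open>Some\<close>.\<close>

lemma gram_inverse_exists:
  obtains B where "mat_inverse (A\<^sup>T * A) = Some B" "B \<in> carrier_mat m m"
    "B * (A\<^sup>T * A) = 1\<^sub>m m" "(A\<^sup>T * A) * B = 1\<^sub>m m"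
proof -
  have G: "A\<^sup>T * A \<in> carrier_mat m m"
    using A by simp
  have "det (A\<^sup>T * A) \<noteq> 0"
  proof
    assume "det (A\<^sup>T * A) = 0"
    then obtain x where x: "x \<in> carrier_vec m" "x \<noteq> 0\<^sub>v m" "(A\<^sup>T * A) *\<^sub>v x = 0\<^sub>v m"
      using det_0_iff_vec_prod_zero_field[OF G] by auto
    have Ax: "A *\<^sub>v x \<in> carrier_vec n"
      using A x(1) by (rule mult_mat_vec_carrier)
    have "(A *\<^sub>v x) \<bullet> (A *\<^sub>v x) = x \<bullet> ((A\<^sup>T * A) *\<^sub>v x)"
      using mult_mat_vec_scalar_prod[OF A x(1) Ax] A x(1) by simp
    also have "\<dots> = 0"
      using x by simp
    finally have "norm2_vec (A *\<^sub>v x) = 0"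
      by (simp add: norm2_vec_def)
    then have "A *\<^sub>v x = 0\<^sub>v n"
      using norm2_vec_eq_0_iff[OF Ax] by simp
    with inj x show False
      by blast
  qed
  then have "A\<^sup>T * A \<in> Units (ring_mat TYPE(real) m ())"
    by (rule det_non_zero_imp_unit[OF G])
  then obtain B where B: "mat_inverse (A\<^sup>T * A) = Some B"
    using mat_inverse(1)[OF G] by fastforce
  show thesis
    using that[OF B] mat_inverse(2)[OF G B] by blast
qed

lemma pinv_carrier: "pinv A \<in> carrier_mat m n"
  and pinv_left_inverse: "pinv A * A = 1\<^sub>m m"
  and gram_mult_pinv: "A\<^sup>T * A * pinv A = A\<^sup>T"
proof -
  obtain B where B: "mat_inverse (A\<^sup>T * A) = Some B" "B \<in> carrier_mat m m"
    "B * (A\<^sup>T * A) = 1\<^sub>m m" "(A\<^sup>T * A) * B = 1\<^sub>m m"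
    by (rule gram_inverse_exists)
  have pinv: "pinv A = B * A\<^sup>T"
    by (simp add: pinv_def B)
  show "pinv A \<in> carrier_mat m n"
    using A B by (simp add: pinv)
  show "pinv A * A = 1\<^sub>m m"
    using A B by (simp add: pinv assoc_mult_mat[of _ m m _ n _ m])
  have "A\<^sup>T * A * (B * A\<^sup>T) = A\<^sup>T * A * B * A\<^sup>T"
    using A B(2) by (intro assoc_mult_mat[symmetric]) auto
  then show "A\<^sup>T * A * pinv A = A\<^sup>T"
    using A by (simp add: pinv B)
qed

text \<open>\<open>A * pinv A\<close> is the orthogonal projection onto the column space of
  \<open>A\<close>, hence a contraction.\<close>

lemma norm2_vec_mult_pinv_le:
  assumes r: "r \<in> carrier_vec n"
  shows "norm2_vec (A *\<^sub>v (pinv A *\<^sub>v r)) \<le> norm2_vec r"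
proof -
  let ?x = "pinv A *\<^sub>v r" and ?p = "A *\<^sub>v (pinv A *\<^sub>v r)"
  have x: "?x \<in> carrier_vec m" and p: "?p \<in> carrier_vec n"
    using pinv_carrier A r by auto
  have "A\<^sup>T *\<^sub>v ?p = (A\<^sup>T * A) *\<^sub>v ?x"
    using A x by simp
  also have "\<dots> = (A\<^sup>T * A * pinv A) *\<^sub>v r"
    using A pinv_carrier r by (intro assoc_mult_mat_vec[symmetric]) auto
  finally have normal: "A\<^sup>T *\<^sub>v ?p = A\<^sup>T *\<^sub>v r"
    by (simp add: gram_mult_pinv)
  have "(norm2_vec ?p)\<^sup>2 = ?x \<bullet> (A\<^sup>T *\<^sub>v ?p)"
    using mult_mat_vec_scalar_prod[OF A x p] by (simp add: norm2_vec_power2)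
  also have "\<dots> = ?p \<bullet> r"
    using mult_mat_vec_scalar_prod[OF A x r] by (simp add: normal)
  also have "\<dots> \<le> norm2_vec ?p * norm2_vec r"
    using carrier_vecD[OF p] carrier_vecD[OF r] by (intro scalar_prod_le_norm2_vec) metis
  finally have "norm2_vec ?p * norm2_vec ?p \<le> norm2_vec ?p * norm2_vec r"
    by (simp add: power2_eq_square)
  \<comment> \<open>The common factor cancels if it is positive; if it is 0, the right-hand side is
    still nonnegative.\<close>
  then show ?thesis
    using norm2_vec_nonneg[of r] norm2_vec_nonneg[of ?p] mult_le_cancel_left
    by (metis order_le_less)
qed

end

section \<open>Moving mean and deviation\<close>

lemma sum_eq_moving_mean:
  assumes "n \<ge> 1"
  shows "(\<Sum>i<n. x (k - i)) = real n * moving_mean n x k"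
  using assms by (simp add: moving_mean_def)

text \<open>Expanding the squares turns the radicand into the mean squared deviation, which shows
  its sign.\<close>

lemma moving_dev_eq_L2_set:
  assumes "n \<ge> 1"
  shows "moving_dev n x k = L2_set (\<lambda>i. x (k - i) - moving_mean n x k) {..<n} / sqrt (real n)"
proof -
  let ?m = "moving_mean n x k"
  have "(\<Sum>i<n. (x (k - i) - ?m)\<^sup>2) = (\<Sum>i<n. (x (k - i))\<^sup>2) - 2 * ?m * (\<Sum>i<n. x (k - i)) + real n * ?m\<^sup>2"
    by (simp add: power2_diff sum.distrib sum_subtractf sum_distrib_left algebra_simps)
  also have "\<dots> = (\<Sum>i<n. (x (k - i))\<^sup>2) - real n * ?m\<^sup>2"
    using assms by (simp add: sum_eq_moving_mean power2_eq_square)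
  finally have "(1 / real n) * (\<Sum>i<n. (x (k - i))\<^sup>2) - ?m\<^sup>2 = (\<Sum>i<n. (x (k - i) - ?m)\<^sup>2) / real n"
    using assms by (simp add: field_simps)
  then show ?thesis
    by (simp add: moving_dev_def L2_set_def real_sqrt_divide)
qed

lemma moving_dev_nonneg: "n \<ge> 1 \<Longrightarrow> 0 \<le> moving_dev n x k"
  by (simp add: moving_dev_eq_L2_set)

lemma L2_set_centered:
  "n \<ge> 1 \<Longrightarrow> L2_set (\<lambda>i. x (k - i) - moving_mean n x k) {..<n} = sqrt (real n) * moving_dev n x k"
  by (simp add: moving_dev_eq_L2_set)

lemma sum_squares_eq_moving:
  assumes "n \<ge> 1"
  shows "(\<Sum>i<n. (x (k - i))\<^sup>2) = real n * ((moving_dev n x k)\<^sup>2 + (moving_mean n x k)\<^sup>2)"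
proof -
  \<comment> \<open>\<open>sqrt\<close> is odd on the reals, so a nonnegative root means a
    nonnegative radicand, and squaring undoes the root.\<close>
  have "0 \<le> moving_dev n x k"
    using assms by (rule moving_dev_nonneg)
  then have "(moving_dev n x k)\<^sup>2 = (1 / real n) * (\<Sum>i<n. (x (k - i))\<^sup>2) - (moving_mean n x k)\<^sup>2"
    by (simp add: moving_dev_def)
  then show ?thesis
    using assms by (simp add: field_simps)
qed

section \<open>The two-column regressor and its lower bound\<close>

lemma regressor_carrier: "regressor n e k \<in> carrier_mat n 2"
  unfolding regressor_def
  using mat_of_cols_carrier(1)[of n "[vec n (\<lambda>_. 1), window n e k]"]
  by (simp add: numeral_2_eq_2)

lemma scalar_prod_vec_2:
  "x \<in> carrier_vec 2 \<Longrightarrow> y \<bullet> x = y $ 0 * x $ 0 + y $ 1 * x $ 1"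
  by (auto simp: scalar_prod_def numeral_2_eq_2)

lemma regressor_mult_vec:
  assumes x: "x \<in> carrier_vec 2"
  shows "regressor n e k *\<^sub>v x = vec n (\<lambda>i. x $ 0 + x $ 1 * e (k - i))"
proof (rule eq_vecI)
  fix i assume "i < dim_vec (vec n (\<lambda>i. x $ 0 + x $ 1 * e (k - i)))"
  then have i: "i < n"
    by simp
  then have "(regressor n e k *\<^sub>v x) $ i = row (regressor n e k) i \<bullet> x"
    using regressor_carrier[of n e k] by simp
  also have "\<dots> = vec n (\<lambda>i. x $ 0 + x $ 1 * e (k - i)) $ i"
    using i by (simp add: scalar_prod_vec_2[OF x] regressor_def mat_of_cols_def window_def)
  finally show "(regressor n e k *\<^sub>v x) $ i = vec n (\<lambda>i. x $ 0 + x $ 1 * e (k - i)) $ i" .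
qed (use regressor_carrier[of n e k] in simp)

lemma norm2_vec_regressor_power2:
  assumes n: "n \<ge> 1" and x: "x \<in> carrier_vec 2"
  shows "(norm2_vec (regressor n e k *\<^sub>v x))\<^sup>2 =
    real n * ((x $ 0 + x $ 1 * moving_mean n e k)\<^sup>2 + (x $ 1)\<^sup>2 * (moving_dev n e k)\<^sup>2)"
proof -
  let ?a = "x $ 0" and ?b = "x $ 1"
  have "(norm2_vec (regressor n e k *\<^sub>v x))\<^sup>2 = (\<Sum>i<n. (?a + ?b * e (k - i))\<^sup>2)"
    unfolding norm2_vec_power2 regressor_mult_vec[OF x]
    by (simp add: scalar_prod_def lessThan_atLeast0 flip: power2_eq_square)
  also have "\<dots> = real n * ?a\<^sup>2 + 2 * ?a * ?b * (\<Sum>i<n. e (k - i)) + ?b\<^sup>2 * (\<Sum>i<n. (e (k - i))\<^sup>2)"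
    by (simp add: power2_sum power_mult_distrib sum.distrib sum_distrib_left ac_simps)
  also have "\<dots> = real n * ((?a + ?b * moving_mean n e k)\<^sup>2 + ?b\<^sup>2 * (moving_dev n e k)\<^sup>2)"
    unfolding sum_eq_moving_mean[OF n] sum_squares_eq_moving[OF n]
    by (simp add: power2_eq_square algebra_simps)
  finally show ?thesis .
qed

text \<open>For nonzero \<open>v\<close>, the map from \<open>(a, b)\<close> to
  \<open>(a + b * m, b * v)\<close> has an inverse with squared Frobenius norm
  \<open>(v\<^sup>2 + m\<^sup>2 + 1) / v\<^sup>2\<close>, and this bounds its squared operator
  norm.\<close>

lemma shear_bound:
  fixes a b m v :: real
  shows "v\<^sup>2 * (a\<^sup>2 + b\<^sup>2) \<le> (v\<^sup>2 + m\<^sup>2 + 1) * ((a + b * m)\<^sup>2 + b\<^sup>2 * v\<^sup>2)"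
proof -
  \<comment> \<open>With \<open>p = a + b * m\<close> and \<open>q = b * v\<close>, one has
    \<open>v * a = v * p - m * q\<close>. Lagrange's identity for \<open>(v, m)\<close> and
    \<open>(p, q)\<close> yields the first square; the remaining 1 contributes
    \<open>p\<^sup>2\<close>.\<close>
  have "(v\<^sup>2 + m\<^sup>2 + 1) * ((a + b * m)\<^sup>2 + b\<^sup>2 * v\<^sup>2) - v\<^sup>2 * (a\<^sup>2 + b\<^sup>2) =
      (m * (a + b * m) + b * v\<^sup>2)\<^sup>2 + (a + b * m)\<^sup>2"
    by (simp add: power2_eq_square algebra_simps)
  then show ?thesis
    by (smt (verit) zero_le_power2)
qed

lemma norm2_vec_le_regressor:
  assumes n: "n \<ge> 1" and dev: "moving_dev n e k \<noteq> 0" and x: "x \<in> carrier_vec 2"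
  shows "norm2_vec x \<le> cond_const n e k / (sqrt (real n) * moving_dev n e k)
    * norm2_vec (regressor n e k *\<^sub>v x)"
proof -
  let ?v = "moving_dev n e k" and ?m = "moving_mean n e k"
  have v: "0 < ?v"
    using moving_dev_nonneg[OF n, of e k] dev by simp
  have "(sqrt (real n) * ?v * norm2_vec x)\<^sup>2 = real n * (?v\<^sup>2 * ((x $ 0)\<^sup>2 + (x $ 1)\<^sup>2))"
    using scalar_prod_vec_2[OF x, of x] by (simp add: power_mult_distrib norm2_vec_power2 flip: power2_eq_square)
  also have "\<dots> \<le> real n * ((?v\<^sup>2 + ?m\<^sup>2 + 1) * ((x $ 0 + x $ 1 * ?m)\<^sup>2 + (x $ 1)\<^sup>2 * ?v\<^sup>2))"
    by (intro mult_left_mono shear_bound) simp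
  also have "\<dots> = (cond_const n e k * norm2_vec (regressor n e k *\<^sub>v x))\<^sup>2"
    by (simp add: power_mult_distrib norm2_vec_regressor_power2[OF n x] cond_const_def)
  finally have "sqrt (real n) * ?v * norm2_vec x \<le> cond_const n e k * norm2_vec (regressor n e k *\<^sub>v x)"
    by (rule power2_le_imp_le) (simp add: cond_const_def norm2_vec_nonneg)
  then show ?thesis
    using v n by (simp add: field_simps)
qed

text \<open>The lower bound gives full column rank, as the pseudoinverse lemmas require.\<close>

lemma regressor_inj:
  assumes n: "n \<ge> 1" and dev: "moving_dev n e k \<noteq> 0"
    and x: "x \<in> carrier_vec 2" and "regressor n e k *\<^sub>v x = 0\<^sub>v n"
  shows "x = 0\<^sub>v 2"
proof -
  have "norm2_vec x \<le> 0"
    using norm2_vec_le_regressor[OF n dev x] assms(4) by (simp add: norm2_vec_def)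
  then show ?thesis
    using norm2_vec_nonneg[of x] norm2_vec_eq_0_iff[OF x] by linarith
qed

section \<open>Norm bound for the regression operator\<close>

lemma norm2_vec_regression_le:
  assumes n: "n \<ge> 1" and dev: "moving_dev n e k \<noteq> 0"
  shows "norm2_vec (regression n e r k)
    \<le> cond_const n e k / (sqrt (real n) * moving_dev n e k) * norm2_vec (window n r k)"
proof -
  note inj = regressor_inj[OF n dev]
  note P = pinv_carrier[OF regressor_carrier[of n e k] inj]
  have w: "window n r k \<in> carrier_vec n"
    by (simp add: window_def)
  have x: "regression n e r k \<in> carrier_vec 2"
    unfolding regression_def using P w by (rule mult_mat_vec_carrier)
  have "norm2_vec (regression n e r k) \<le> cond_const n e k / (sqrt (real n) * moving_dev n e k)
      * norm2_vec (regressor n e k *\<^sub>v regression n e r k)"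
    by (rule norm2_vec_le_regressor[OF n dev x])
  also have "\<dots> \<le> cond_const n e k / (sqrt (real n) * moving_dev n e k) * norm2_vec (window n r k)"
    using norm2_vec_mult_pinv_le[OF regressor_carrier[of n e k] inj w]
    by (intro mult_left_mono)
      (auto simp: regression_def cond_const_def moving_dev_nonneg[OF n])
  finally show ?thesis .
qed

section \<open>Regression error as a regression of centred signals\<close>

lemma regression_error:
  assumes n: "n \<ge> 1" and dev: "moving_dev n e k \<noteq> 0" and t: "t \<in> carrier_vec 2"
  shows "regression n e (\<lambda>j. y1 j + e j * y2 j) k - t
    = regression n e (\<lambda>j. (y1 j - t $ 0) + e j * (y2 j - t $ 1)) k"
proof -
  let ?A = "regressor n e k"
  let ?w = "window n (\<lambda>j. (y1 j - t $ 0) + e j * (y2 j - t $ 1)) k"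
  note inj = regressor_inj[OF n dev]
  note P = pinv_carrier[OF regressor_carrier[of n e k] inj]
  have w: "?w \<in> carrier_vec n"
    by (simp add: window_def)
  have At: "?A *\<^sub>v t \<in> carrier_vec n"
    using regressor_carrier t by (rule mult_mat_vec_carrier)
  have Pw: "pinv ?A *\<^sub>v ?w \<in> carrier_vec 2"
    using P w by (rule mult_mat_vec_carrier)
  \<comment> \<open>For any \<open>t\<close>, the data split into the exact model output
    \<open>t $ 0 + t $ 1 * e\<close> and a residual; the pseudoinverse recovers \<open>t\<close>
    from the first.\<close>
  have "window n (\<lambda>j. y1 j + e j * y2 j) k = ?A *\<^sub>v t + ?w"
    by (rule eq_vecI) (simp_all add: window_def regressor_mult_vec[OF t] algebra_simps)
  then have "regression n e (\<lambda>j. y1 j + e j * y2 j) k = pinv ?A *\<^sub>v (?A *\<^sub>v t) + pinv ?A *\<^sub>v ?w"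
    using mult_add_distrib_mat_vec[OF P At w] by (simp add: regression_def)
  also have "pinv ?A *\<^sub>v (?A *\<^sub>v t) = t"
    using assoc_mult_mat_vec[OF P regressor_carrier[of n e k] t]
      pinv_left_inverse[OF regressor_carrier[of n e k] inj] t by simp
  finally have "regression n e (\<lambda>j. y1 j + e j * y2 j) k = t + pinv ?A *\<^sub>v ?w" .
  moreover have "t + u - t = u" if "u \<in> carrier_vec 2" for u
    using t that by (intro eq_vecI) auto
  ultimately show ?thesis
    using Pw by (simp add: regression_def)
qed

lemma norm_inf_vec_ge: "i < dim_vec v \<Longrightarrow> \<bar>v $ i\<bar> \<le> norm_inf_vec v"
  unfolding norm_inf_vec_def by (intro Max_ge) auto

lemma norm2_vec_centered_le:
  assumes n: "n \<ge> 1"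
  shows "norm2_vec (window n (\<lambda>j. (y1 j - moving_mean n y1 k) + e j * (y2 j - moving_mean n y2 k)) k)
    \<le> sqrt (real n) * (moving_dev n y1 k + moving_dev n y2 k * norm_inf_vec (window n e k))"
proof -
  let ?c1 = "\<lambda>i. y1 (k - i) - moving_mean n y1 k" and ?c2 = "\<lambda>i. y2 (k - i) - moving_mean n y2 k"
  let ?M = "norm_inf_vec (window n e k)"
  have M: "\<bar>e (k - i)\<bar> \<le> ?M" if "i < n" for i
    using norm_inf_vec_ge[of i "window n e k"] that by (simp add: window_def)
  \<comment> \<open>As \<open>n \<ge> 1\<close>, the window is nonempty and \<open>?M\<close>
    dominates an absolute value.\<close>
  have M0: "0 \<le> ?M"
    using M[of 0] n by linarith
  have "norm2_vec (window n (\<lambda>j. (y1 j - moving_mean n y1 k) + e j * (y2 j - moving_mean n y2 k)) k)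
      = L2_set (\<lambda>i. ?c1 i + e (k - i) * ?c2 i) {..<n}"
    by (simp add: norm2_vec_eq_L2_set window_def L2_set_def)
  also have "\<dots> \<le> L2_set ?c1 {..<n} + L2_set (\<lambda>i. e (k - i) * ?c2 i) {..<n}"
    by (rule L2_set_triangle_ineq)
  \<comment> \<open>Absolute values leave the squares unchanged and provide the nonnegative terms
    that monotonicity of \<open>L2_set\<close> needs.\<close>
  also have "L2_set (\<lambda>i. e (k - i) * ?c2 i) {..<n} = L2_set (\<lambda>i. \<bar>e (k - i)\<bar> * \<bar>?c2 i\<bar>) {..<n}"
    by (simp add: L2_set_def power_mult_distrib)
  also have "\<dots> \<le> L2_set (\<lambda>i. ?M * \<bar>?c2 i\<bar>) {..<n}"
    using M by (intro L2_set_mono mult_right_mono) auto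
  also have "\<dots> = ?M * L2_set ?c2 {..<n}"
    using M0 by (simp add: L2_set_right_distrib) (simp add: L2_set_def power_mult_distrib)
  finally show ?thesis
    using n by (simp add: L2_set_centered algebra_simps)
qed

theorem proposition3p3:
  fixes n k :: nat and r e y1 y2 :: signal
  assumes "n \<ge> 1" and "k \<ge> n - 1" and "moving_dev n e k \<noteq> 0"
  shows "norm2_vec (regression n e (\<lambda>j. y1 j + e j * y2 j) k - moving_mean2 n y1 y2 k)
           \<le> cond_const n e k / moving_dev n e k
              * (moving_dev n y1 k + moving_dev n y2 k * norm_inf_vec (window n e k))
       \<and> norm2_vec (regression n e r k)
           \<le> cond_const n e k / (sqrt (real n) * moving_dev n e k) * norm2_vec (window n r k)"
proof
  let ?s = "\<lambda>j. (y1 j - moving_mean n y1 k) + e j * (y2 j - moving_mean n y2 k)"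
  let ?K = "cond_const n e k / (sqrt (real n) * moving_dev n e k)"
  let ?B = "moving_dev n y1 k + moving_dev n y2 k * norm_inf_vec (window n e k)"
  note n = assms(1) and dev = assms(3)
  have mean: "moving_mean2 n y1 y2 k \<in> carrier_vec 2"
    "moving_mean2 n y1 y2 k $ 0 = moving_mean n y1 k" "moving_mean2 n y1 y2 k $ 1 = moving_mean n y2 k"
    by (auto simp: moving_mean2_def intro: carrier_vecI)
  \<comment> \<open>Taking \<open>t\<close> to be the vector of means makes the residuals centred,
    so their norms are deviations.\<close>
  have "norm2_vec (regression n e (\<lambda>j. y1 j + e j * y2 j) k - moving_mean2 n y1 y2 k)
      = norm2_vec (regression n e ?s k)"
    using regression_error[OF n dev mean(1), of y1 y2] by (simp only: mean(2,3))
  also have "\<dots> \<le> ?K * norm2_vec (window n ?s k)"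
    by (rule norm2_vec_regression_le[OF n dev])
  also have "\<dots> \<le> ?K * (sqrt (real n) * ?B)"
    by (intro mult_left_mono norm2_vec_centered_le[OF n])
      (simp add: cond_const_def moving_dev_nonneg[OF n])
  \<comment> \<open>The root of \<open>n\<close> from the window length cancels the one in
    \<open>?K\<close>.\<close>
  also have "\<dots> = cond_const n e k / moving_dev n e k * ?B"
    using n by simp
  finally show "norm2_vec (regression n e (\<lambda>j. y1 j + e j * y2 j) k - moving_mean2 n y1 y2 k)
      \<le> cond_const n e k / moving_dev n e k * ?B" .
  show "norm2_vec (regression n e r k) \<le> ?K * norm2_vec (window n r k)"
    by (rule norm2_vec_regression_le[OF n dev])
qed

end
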